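(* Let $\{P_n\}$ be a sequence of polynomials (in the variable $x=x(s)$, $\deg P_n=n$) orthogonal with respect to a weight function $W$ on $(a,b)$. If $\{\mathbb{D}_x^2P_n\}$ is orthogonal with respect to the weight function $\pi W$, where $\pi$ is a polynomial of degree at most $4$, then there exist sequences $\{b_{n,n+j}\}$, $j=-2,-1,0,1,2$, such that $$P_n=\sum_{j=-2}^{2}b_{n,n+j}\,\mathbb{D}_x^2P_{n+j},\qquad b_{n,n+2}\neq0,\qquad n=2,3,\dots.$$
   Context: The lattice is $x(s)=c_1q^{-s}+c_2q^{s}+c_3$ with $c_1\ne0$ if $q\neq1$, and $x(s)=c_4s^2+c_5s+c_6$ with $c_4\neq0$ if $q=1$; $q>0$ is fixed. For a polynomial $f$, $\mathbb{D}_xf(x(s))=\dfrac{f(x(s+\frac12))-f(x(s-\frac12))}{x(s+\frac12)-x(s-\frac12)}$, which is a polynomial in $x$. Orthogonality of $\{P_n\}_{n\ge0}$ with respect to $W$ on $(a,b)$ means $\int_a^bP_mP_nW\,dx=d_n\delta_{mn}$, $d_n>0$; orthogonality of $\{\mathbb{D}_x^2P_n\}$ (indexed by $n\ge2$) with respect to $\pi W$ means $\int_a^b\mathbb{D}_x^2P_m\,\mathbb{D}_x^2P_n\,\pi W\,dx$ is $0$ for $m\ne n$ and nonzero for $m=n$. *)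

theory Defs
  imports "HOL-Analysis.Analysis" "HOL-Computational_Algebra.Polynomial"
begin

(* The constants and the variable s are complex: for instance the Askey-Wilson
   lattice x(s) = (q^s + q^(-s))/2 takes values in (-1,1) only at non-real s. *)
definition is_lattice :: "real \<Rightarrow> (complex \<Rightarrow> complex) \<Rightarrow> bool" where
  "is_lattice q x \<longleftrightarrow>
     (q \<noteq> 1 \<longrightarrow> (\<exists>c1 c2 c3. c1 \<noteq> 0 \<and>
        (\<forall>s. x s = c1 * complex_of_real q powr (- s) + c2 * complex_of_real q powr s + c3))) \<and>
     (q = 1 \<longrightarrow> (\<exists>c4 c5 c6. c4 \<noteq> 0 \<and> (\<forall>s. x s = c4 * s ^ 2 + c5 * s + c6)))"

(* The polynomial g with g(x(s)) equal to the divided difference of f at x(s + 1/2), x(s - 1/2).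
   Isolated s at which these two nodes coincide are excluded, since there the quotient is
   meaningless (and 0 by the convention on division in HOL). *)
definition Dx :: "(complex \<Rightarrow> complex) \<Rightarrow> complex poly \<Rightarrow> complex poly" where
  "Dx x f = (THE g. \<forall>s. x (s + 1/2) \<noteq> x (s - 1/2) \<longrightarrow>
     poly g (x s) =
       (poly f (x (s + 1/2)) - poly f (x (s - 1/2))) / (x (s + 1/2) - x (s - 1/2)))"

definition weight_function :: "ereal \<Rightarrow> ereal \<Rightarrow> (real \<Rightarrow> real) \<Rightarrow> bool" where
  "weight_function a b W \<longleftrightarrow>
     (\<forall>t\<in>einterval a b. 0 \<le> W t) \<and>
     (\<forall>k::nat. set_integrable lebesgue (einterval a b) (\<lambda>t. t ^ k * W t))"

(* The bilinear pairing (no complex conjugation), for a possibly complex-valued density w. *)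
definition pairing ::
    "ereal \<Rightarrow> ereal \<Rightarrow> (real \<Rightarrow> complex) \<Rightarrow> complex poly \<Rightarrow> complex poly \<Rightarrow> complex" where
  "pairing a b w f g =
     set_lebesgue_integral lebesgue (einterval a b)
       (\<lambda>t. poly f (complex_of_real t) * poly g (complex_of_real t) * w t)"

end

theory Submission
  imports Defs
begin

text \<open>
  Since \<open>D\<^sub>x\<close> lowers every positive degree by exactly one,
  \<open>Q\<^sub>k = D\<^sub>x\<^sup>2 P\<^sub>k\<close> has degree \<open>k - 2\<close> for \<open>k \<ge> 2\<close>. Hence
  \<open>Q\<^sub>2, Q\<^sub>3, \<dots>\<close> is a graded basis of the polynomials, and \<open>P\<^sub>n\<close> is a combination of
  \<open>Q\<^sub>2, \<dots>, Q\<^sub>n\<^sub>+\<^sub>2\<close> whose top coefficient cannot vanish, by comparison of degrees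
  (\<open>expand_in_graded_basis\<close>). Pairing the expansion with \<open>Q\<^sub>k\<close> against the weight
  \<open>\<pi> W\<close> isolates a nonzero multiple of the coefficient at \<open>Q\<^sub>k\<close>. The same pairing is the
  \<open>W\<close>-pairing of \<open>P\<^sub>n\<close> with \<open>\<pi> Q\<^sub>k\<close>, a polynomial of degree at most
  \<open>4 + (k - 2)\<close>, so it is zero as soon as \<open>k < n - 2\<close>. Only the five terms
  \<open>k = n - 2, \<dots>, n + 2\<close> survive.

  The substance is therefore the claim about \<open>D\<^sub>x\<close>, which includes that the divided
  difference is a polynomial in \<open>x(s)\<close> at all. Both families of lattices share one property
  (\<open>is_lattice_quadratic\<close>): the two nodes \<open>y = x(s + 1/2)\<close> and
  \<open>z = x(s - 1/2)\<close> have a sum \<open>S\<close> of degree one and a product \<open>T\<close> of degree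
  two in \<open>x(s)\<close>. The symmetric polynomial \<open>(y\<^sup>n - z\<^sup>n) / (y - z)\<close> is the
  \<open>n\<close>-th Lucas polynomial in \<open>S\<close> and \<open>T\<close>, so it is a polynomial in
  \<open>x(s)\<close>. Its coefficient of degree \<open>n - 1\<close> is the real Lucas number with parameters
  \<open>\<sigma>\<close> and \<open>1\<close>, where \<open>\<sigma>\<close> is the slope of \<open>S\<close>; it is positive because
  \<open>\<sigma> = q\<^sup>1\<^sup>/\<^sup>2 + q\<^sup>-\<^sup>1\<^sup>/\<^sup>2 \<ge> 2\<close> (\<open>degree_Dx\<close>).
\<close>

section \<open>Lucas polynomials\<close>

text \<open>
  The Lucas sequence of the first kind, over an arbitrary ring: it is used for polynomials, for
  their values, and for the real sequence of their leading coefficients.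
\<close>

fun lucas :: "'a::comm_ring_1 \<Rightarrow> 'a \<Rightarrow> nat \<Rightarrow> 'a" where
  "lucas S T 0 = 0"
| "lucas S T (Suc 0) = 1"
| "lucas S T (Suc (Suc n)) = S * lucas S T (Suc n) - T * lucas S T n"

lemma diff_times_lucas: "(y - z) * lucas (y + z) (y * z) n = y ^ n - z ^ n"
proof (induction n rule: induct_nat_012)
  case (ge2 n)
  have "(y - z) * lucas (y + z) (y * z) (Suc (Suc n))
      = (y + z) * ((y - z) * lucas (y + z) (y * z) (Suc n)) - y * z * ((y - z) * lucas (y + z) (y * z) n)"
    by (simp add: algebra_simps)
  also have "\<dots> = y ^ Suc (Suc n) - z ^ Suc (Suc n)"
    unfolding ge2 by (simp add: algebra_simps)
  finally show ?case .
qed simp_all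

lemma poly_lucas: "poly (lucas S T n) t = lucas (poly S t) (poly T t) n"
  by (induction n rule: induct_nat_012) simp_all

text \<open>
  A slope of at least 2 makes the sequence convex, so its increments never fall below the first
  one. This gives positivity for all indices without the closed form in \<open>q\<close>, and covers
  \<open>q = 1\<close>, where the sequence is \<open>n\<close> itself.
\<close>

lemma lucas_real_grows:
  fixes \<sigma> :: real
  assumes "2 \<le> \<sigma>"
  shows "0 \<le> lucas \<sigma> 1 n \<and> lucas \<sigma> 1 n + 1 \<le> lucas \<sigma> 1 (Suc n)"
proof (induction n)
  case (Suc n)
  have "2 * lucas \<sigma> 1 (Suc n) \<le> \<sigma> * lucas \<sigma> 1 (Suc n)"
    using assms Suc by (intro mult_right_mono) auto
  with Suc have "lucas \<sigma> 1 (Suc n) + 1 \<le> \<sigma> * lucas \<sigma> 1 (Suc n) - lucas \<sigma> 1 n"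
    by linarith
  with Suc show ?case by simp
qed simp

text \<open>
  Reading the recursion at the highest degree turns \<open>S\<close> into its slope and \<open>T\<close> into
  its leading coefficient 1. At \<open>n = 0\<close> the truncated index \<open>n - 1 = 0\<close> is harmless, as
  the Lucas polynomial vanishes there.
\<close>

lemma lucas_degree_coeff:
  fixes s0 t0 t1 :: complex
  defines "S \<equiv> \<lambda>\<sigma>. [:s0, complex_of_real \<sigma>:]" and "T \<equiv> [:t0, t1, 1:]"
  shows "degree (lucas (S \<sigma>) T n) \<le> n - 1
       \<and> coeff (lucas (S \<sigma>) T n) (n - 1) = of_real (lucas \<sigma> 1 n)"
proof (induction n rule: induct_nat_012)
  case (ge2 n)
  let ?U = "lucas (S \<sigma>) T"
  have dS: "degree (S \<sigma> * ?U (Suc n)) \<le> Suc n"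
  proof (rule order.trans[OF degree_mult_le])
    have "degree (S \<sigma>) \<le> 1" by (simp add: S_def)
    with ge2(2) show "degree (S \<sigma>) + degree (?U (Suc n)) \<le> Suc n" by simp
  qed
  have dT: "degree (T * ?U n) \<le> Suc n"
  proof (cases n)
    case (Suc k)
    then show ?thesis
      using ge2(1) by (intro order.trans[OF degree_mult_le]) (simp add: T_def)
  qed simp
  have cT: "coeff (T * ?U n) (Suc n) = of_real (lucas \<sigma> 1 n)"
  proof (cases n)
    case (Suc k)
    have "coeff (?U n) (Suc k) = 0" "coeff (?U n) (Suc (Suc k)) = 0"
      using ge2(1) Suc by (auto intro: coeff_eq_0)
    then show ?thesis
      using ge2(1) Suc by (simp add: T_def del: lucas.simps)
  qed simp
  have cS: "coeff (S \<sigma> * ?U (Suc n)) (Suc n) = of_real (\<sigma> * lucas \<sigma> 1 (Suc n))"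
  proof -
    have "coeff (?U (Suc n)) (Suc n) = 0"
      using ge2(2) by (auto intro: coeff_eq_0)
    then show ?thesis
      using ge2(2) by (simp add: S_def del: lucas.simps)
  qed
  show ?case
    using degree_diff_le[OF dS dT] cS cT by simp
qed simp_all

section \<open>The divided difference on a quadratic lattice\<close>

text \<open>
  With \<open>S\<close> and \<open>T\<close> the sum and product of the two nodes, \<open>S\<^sup>2 - 4 T\<close> is the
  square of their difference. That it is not the zero polynomial says that the nodes coincide only
  for finitely many values of \<open>x(s)\<close>; together with the infinite range this makes the polynomial
  divided difference unique.
\<close>

locale quadratic_lattice =
  fixes x :: "complex \<Rightarrow> complex" and \<sigma> :: real and s0 t0 t1 :: complex
  assumes sigma_ge_2: "2 \<le> \<sigma>"
    and nodes_sum: "\<And>s. x (s + 1/2) + x (s - 1/2) = poly [:s0, of_real \<sigma>:] (x s)"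
    and nodes_prod: "\<And>s. x (s + 1/2) * x (s - 1/2) = poly [:t0, t1, 1:] (x s)"
    and discriminant: "[:s0, of_real \<sigma>:]\<^sup>2 \<noteq> 4 * [:t0, t1, 1:]"
    and infinite_range: "infinite (range x)"
begin

abbreviation U :: "nat \<Rightarrow> complex poly" where
  "U \<equiv> lucas [:s0, of_real \<sigma>:] [:t0, t1, 1:]"

lemma divided_difference_poly:
  "(x (s + 1/2) - x (s - 1/2)) * poly (\<Sum>i\<le>degree f. smult (coeff f i) (U i)) (x s)
     = poly f (x (s + 1/2)) - poly f (x (s - 1/2))"
proof -
  have "(x (s + 1/2) - x (s - 1/2)) * poly (U i) (x s) = x (s + 1/2) ^ i - x (s - 1/2) ^ i" for i
    unfolding poly_lucas nodes_sum[symmetric] nodes_prod[symmetric] by (rule diff_times_lucas)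
  then have "(x (s + 1/2) - x (s - 1/2)) * poly (\<Sum>i\<le>degree f. smult (coeff f i) (U i)) (x s)
      = (\<Sum>i\<le>degree f. coeff f i * (x (s + 1/2) ^ i - x (s - 1/2) ^ i))"
    by (simp add: poly_sum sum_distrib_left mult.left_commute)
  then show ?thesis
    by (simp add: poly_altdef sum_subtractf[symmetric] right_diff_distrib[symmetric])
qed

text \<open>
  The product of \<open>g - h\<close> with the discriminant \<open>S\<^sup>2 - 4 T\<close> vanishes at every lattice
  value: the first factor does so by hypothesis where the nodes differ, and the second where they
  coincide. A polynomial with infinitely
  many roots is zero.
\<close>

lemma agree_off_coincident_nodes:
  assumes "\<And>s. x (s + 1/2) \<noteq> x (s - 1/2) \<Longrightarrow> poly g (x s) = poly h (x s)"
  shows "g = h"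
proof -
  let ?\<Delta> = "[:s0, of_real \<sigma>:]\<^sup>2 - 4 * [:t0, t1, 1:]"
  have "poly (?\<Delta> * (g - h)) (x s) = 0" for s
  proof (cases "x (s + 1/2) = x (s - 1/2)")
    case True
    have "poly ?\<Delta> (x s) = (poly [:s0, of_real \<sigma>:] (x s))\<^sup>2 - 4 * poly [:t0, t1, 1:] (x s)"
      unfolding poly_diff poly_mult poly_power by simp
    also have "\<dots> = (x (s + 1/2) - x (s - 1/2))\<^sup>2"
      unfolding nodes_sum[symmetric] nodes_prod[symmetric]
      by (simp add: power2_eq_square algebra_simps)
    finally have "poly ?\<Delta> (x s) = 0" using True by simp
    then show ?thesis unfolding poly_mult by simp
  next
    case False
    then show ?thesis using assms unfolding poly_mult by simp
  qed
  then have "range x \<subseteq> {z. poly (?\<Delta> * (g - h)) z = 0}" by auto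
  then have "?\<Delta> * (g - h) = 0"
    using infinite_range poly_roots_finite finite_subset by metis
  then show ?thesis using discriminant by simp
qed

lemma Dx_eq_lucas_sum: "Dx x f = (\<Sum>i\<le>degree f. smult (coeff f i) (U i))"
  (is "_ = ?g")
  unfolding Dx_def
proof (rule the_equality)
  show *: "\<forall>s. x (s + 1/2) \<noteq> x (s - 1/2) \<longrightarrow> poly ?g (x s) =
       (poly f (x (s + 1/2)) - poly f (x (s - 1/2))) / (x (s + 1/2) - x (s - 1/2))"
    by (simp add: divided_difference_poly[symmetric])
  show "g = ?g" if "\<forall>s. x (s + 1/2) \<noteq> x (s - 1/2) \<longrightarrow> poly g (x s) =
       (poly f (x (s + 1/2)) - poly f (x (s - 1/2))) / (x (s + 1/2) - x (s - 1/2))" for g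
    using that * by (intro agree_off_coincident_nodes) auto
qed

lemma degree_Dx_le: "degree (Dx x f) \<le> degree f - 1"
  unfolding Dx_eq_lucas_sum
proof (intro degree_sum_le finite_atMost order.trans[OF degree_smult_le])
  fix i assume "i \<in> {..degree f}"
  then show "degree (U i) \<le> degree f - 1"
    using lucas_degree_coeff[of s0 \<sigma> t0 t1 i] by auto
qed

lemma coeff_Dx: "coeff (Dx x f) (degree f - 1) = lead_coeff f * of_real (lucas \<sigma> 1 (degree f))"
proof -
  have "coeff (U i) (degree f - 1) = 0" if "i < degree f" for i
  proof (cases i)
    case (Suc k)
    then show ?thesis
      using that lucas_degree_coeff[of s0 \<sigma> t0 t1 i] by (intro coeff_eq_0) auto
  qed simp
  then have "coeff (Dx x f) (degree f - 1) = lead_coeff f * coeff (U (degree f)) (degree f - 1)"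
    unfolding Dx_eq_lucas_sum lessThan_Suc_atMost[symmetric] by (simp add: coeff_sum)
  then show ?thesis
    using lucas_degree_coeff[of s0 \<sigma> t0 t1 "degree f"] by simp
qed

lemma Dx_degree_0: "degree f = 0 \<Longrightarrow> Dx x f = 0"
  unfolding Dx_eq_lucas_sum by simp

lemma degree_Dx: "degree (Dx x f) = degree f - 1"
proof (cases "degree f")
  case (Suc n)
  have "lucas \<sigma> 1 (Suc n) > 0"
    using lucas_real_grows[OF sigma_ge_2, of n] by auto
  then have "coeff (Dx x f) (degree f - 1) \<noteq> 0"
    using Suc unfolding coeff_Dx by (metis leading_coeff_0_iff degree_0 mult_eq_0_iff nat.distinct(1) of_real_eq_0_iff order_less_irrefl)
  then show ?thesis
    using degree_Dx_le le_degree by (intro antisym) auto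
qed (simp add: Dx_degree_0)

end

section \<open>Both kinds of lattices are quadratic\<close>

text \<open>
  Here \<open>A\<close> and \<open>B\<close> stand for \<open>c\<^sub>1 q\<^sup>-\<^sup>s\<close> and \<open>c\<^sub>2 q\<^sup>s\<close>, and
  \<open>h\<close> for \<open>q\<^sup>1\<^sup>/\<^sup>2\<close>, so that the two factors are the nodes. The product \<open>A B\<close>
  does not depend on \<open>s\<close>, which makes the right-hand side a quadratic polynomial in
  \<open>X\<close>.
\<close>

lemma nodes_product:
  fixes A B c g h :: "'a::comm_ring_1"
  assumes "g * h = 1"
  defines "X \<equiv> A + B + c" and "\<sigma> \<equiv> h + g"
  shows "(A * g + B * h + c) * (A * h + B * g + c)
       = A * B * (h - g) ^ 2 + c ^ 2 * (2 - \<sigma>) + c * (\<sigma> - 2) * X + X ^ 2"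
proof -
  \<comment> \<open>An identity in free variables: the last summand is the multiple of \<open>g * h - 1\<close> by which
    the two sides differ.\<close>
  have "(A * g + B * h + c) * (A * h + B * g + c)
      = A * B * (h - g) ^ 2 + c ^ 2 * (2 - \<sigma>) + c * (\<sigma> - 2) * X + X ^ 2 + (g * h - 1) * (A + B) ^ 2"
    unfolding X_def \<sigma>_def by (simp add: power2_eq_square algebra_simps)
  then show ?thesis using assms(1) by simp
qed

text \<open>
  In both cases the range of \<open>x\<close> is infinite because each value is attained only at the
  roots of a nonzero polynomial of degree at most two: in \<open>s\<close> if \<open>q = 1\<close>, and otherwise in
  \<open>w = q\<^sup>s\<close>, which takes every nonzero complex value. If \<open>q = 1\<close> the discriminant has
  degree one, with slope \<open>4 c\<^sub>4\<close>; otherwise it has degree two, with leading coefficient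
  \<open>\<sigma>\<^sup>2 - 4 > 0\<close>.
\<close>

lemma is_lattice_quadratic:
  assumes "q > 0" "is_lattice q x"
  shows "\<exists>\<sigma> s0 t0 t1. quadratic_lattice x \<sigma> s0 t0 t1"
proof (cases "q = 1")
  case True
  then obtain c4 c5 c6 where c4: "c4 \<noteq> 0" and x: "\<And>s. x s = c4 * s ^ 2 + c5 * s + c6"
    using assms unfolding is_lattice_def by auto
  have "quadratic_lattice x 2 (c4/2) ((c4/4)\<^sup>2 + c4 * c6 - c5\<^sup>2 / 4) (- c4 / 2)"
  proof
    show "infinite (range x)"
    proof
      assume fin: "finite (range x)"
      have "finite {s. poly [:c6 - z, c5, c4:] s = 0}" for z
        using c4 by (intro poly_roots_finite) simp
      then have "finite (\<Union>z\<in>range x. {s. poly [:c6 - z, c5, c4:] s = 0})"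
        using fin by blast
      moreover have "UNIV = (\<Union>z\<in>range x. {s. poly [:c6 - z, c5, c4:] s = 0})"
        by (auto simp: x power2_eq_square algebra_simps)
      ultimately show False
        using infinite_UNIV_char_0[where 'a = complex] by simp
    qed
  next
    show "[:c4/2, complex_of_real 2:]\<^sup>2 \<noteq> 4 * [:(c4/4)\<^sup>2 + c4 * c6 - c5\<^sup>2 / 4, - c4 / 2, 1:]"
    proof
      assume "[:c4/2, complex_of_real 2:]\<^sup>2 = 4 * [:(c4/4)\<^sup>2 + c4 * c6 - c5\<^sup>2 / 4, - c4 / 2, 1:]"
      then have "coeff ([:c4/2, complex_of_real 2:]\<^sup>2) 1
        = coeff (4 * [:(c4/4)\<^sup>2 + c4 * c6 - c5\<^sup>2 / 4, - c4 / 2, 1:]) 1" by simp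
      then show False using c4 by (simp add: power2_eq_square numeral_poly)
    qed
  qed (auto simp: x power2_eq_square field_simps)
  then show ?thesis by blast
next
  case False
  then obtain c1 c2 c3 where c1: "c1 \<noteq> 0"
    and x: "\<And>s. x s = c1 * of_real q powr (- s) + c2 * of_real q powr s + c3"
    using assms unfolding is_lattice_def by auto
  define r where "r = sqrt q"
  define h where "h = complex_of_real r"
  have r: "r > 0" "r\<^sup>2 = q" "r \<noteq> 1"
    using assms False by (auto simp: r_def)
  have h: "h \<noteq> 0" "h\<^sup>2 \<noteq> 1"
    using r False by (auto simp: h_def simp flip: of_real_power)
  have hq: "of_real q powr (1/2) = h"
    using assms powr_of_real[of q "1/2"] by (simp add: h_def r_def powr_half_sqrt)
  have shift: "of_real q powr (s + 1/2) = of_real q powr s * h"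
              "of_real q powr (s - 1/2) = of_real q powr s / h" for s
    by (simp_all add: powr_add powr_diff hq)
  have xs: "x s = c1 / (of_real q powr s) + c2 * of_real q powr s + c3" for s
    by (simp add: x powr_minus divide_inverse)
  define \<sigma> where "\<sigma> = r + 1 / r"
  define k where "k = c1 * c2 * (h - 1/h)\<^sup>2"
  have \<sigma>: "of_real \<sigma> = h + 1 / h" by (simp add: \<sigma>_def h_def)
  have "quadratic_lattice x \<sigma> (c3 * (2 - of_real \<sigma>))
    (k + c3\<^sup>2 * (2 - of_real \<sigma>)) (c3 * (of_real \<sigma> - 2))"
  proof
    have "\<sigma> - 2 = (r - 1)\<^sup>2 / r"
      using r(1) by (simp add: \<sigma>_def power2_eq_square field_simps)
    then have "\<sigma> > 2"
      using r by (metis diff_gt_0_iff_gt divide_pos_pos right_minus_eq zero_less_power2)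
    then show "2 \<le> \<sigma>" by simp
    show "[:c3 * (2 - of_real \<sigma>), of_real \<sigma>:]\<^sup>2
        \<noteq> 4 * [:k + c3\<^sup>2 * (2 - of_real \<sigma>), c3 * (of_real \<sigma> - 2), 1:]"
    proof
      assume "[:c3 * (2 - of_real \<sigma>), of_real \<sigma>:]\<^sup>2
        = 4 * [:k + c3\<^sup>2 * (2 - of_real \<sigma>), c3 * (of_real \<sigma> - 2), 1:]"
      from arg_cong[OF this, of "\<lambda>g. coeff g 2"] have "complex_of_real (\<sigma>\<^sup>2) = of_real 4"
        by (simp add: power2_eq_square numeral_poly numeral_2_eq_2)
      then have "\<sigma>\<^sup>2 = 2\<^sup>2" unfolding of_real_eq_iff by simp
      with \<open>\<sigma> > 2\<close> show False
        by (metis abs_of_pos less_irrefl order_less_trans power2_eq_iff_nonneg less_imp_le zero_less_numeral)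
    qed
    show "infinite (range x)"
    proof
      assume fin: "finite (range x)"
      have "finite {w. poly [:c1, c3 - z, c2:] w = 0}" for z
        using c1 by (intro poly_roots_finite) simp
      then have "finite (\<Union>z\<in>range x. {w. poly [:c1, c3 - z, c2:] w = 0})"
        using fin by blast
      moreover have "- {0} \<subseteq> (\<Union>z\<in>range x. {w. poly [:c1, c3 - z, c2:] w = 0})"
      proof
        fix w :: complex assume w: "w \<in> - {0}"
        have "ln (complex_of_real q) = of_real (ln q)" "ln q \<noteq> 0"
          using assms(1) False by (auto simp: Ln_of_real)
        then have "of_real q powr (ln w / of_real (ln q)) = w"
          using w assms(1) by (simp add: powr_def)
        then have "x (ln w / of_real (ln q)) = c1 / w + c2 * w + c3"
          by (simp add: xs)
        then have "poly [:c1, c3 - x (ln w / of_real (ln q)), c2:] w = 0"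
          using w by (simp add: field_simps)
        then show "w \<in> (\<Union>z\<in>range x. {w. poly [:c1, c3 - z, c2:] w = 0})" by blast
      qed
      ultimately have "finite (- {0 :: complex})" by (rule finite_subset[rotated])
      then show False
        using infinite_UNIV_char_0[where 'a = complex] by (simp add: Compl_eq_Diff_UNIV)
    qed
  next
    fix s
    define A where "A = c1 / of_real q powr s"
    define B where "B = c2 * of_real q powr s"
    have nodes: "x (s + 1/2) = A * (1 / h) + B * h + c3"
        "x (s - 1/2) = A * h + B * (1 / h) + c3" "x s = A + B + c3"
      by (simp_all add: xs shift A_def B_def)
    have k: "k = A * B * (h - 1 / h)\<^sup>2"
      using assms(1) by (simp add: k_def A_def B_def)
    show "x (s + 1/2) + x (s - 1/2) = poly [:c3 * (2 - of_real \<sigma>), of_real \<sigma>:] (x s)"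
      unfolding nodes \<sigma> by (simp add: algebra_simps add_divide_distrib)
    show "x (s + 1/2) * x (s - 1/2)
        = poly [:k + c3\<^sup>2 * (2 - of_real \<sigma>), c3 * (of_real \<sigma> - 2), 1:] (x s)"
      using nodes_product[of "1 / h" h A B c3] h(1)
      unfolding nodes \<sigma> k by (simp add: power2_eq_square algebra_simps add_divide_distrib)
  qed
  then show ?thesis by blast
qed

section \<open>Graded bases and integration against a weight\<close>

text \<open>
  Subtracting the right multiple of \<open>B n\<close> removes the coefficient of degree \<open>n\<close>. The
  relation for \<open>c n\<close> shows that the top coefficient is nonzero when \<open>f\<close> has degree
  exactly \<open>n\<close>.
\<close>

lemma expand_in_graded_basis:
  fixes B :: "nat \<Rightarrow> 'a::field poly"
  assumes deg: "\<And>i. degree (B i) = i" and nz: "\<And>i. B i \<noteq> 0" and "degree f \<le> n"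
  shows "\<exists>c. f = (\<Sum>i\<le>n. smult (c i) (B i)) \<and> c n * coeff (B n) n = coeff f n"
  using \<open>degree f \<le> n\<close>
proof (induction n arbitrary: f)
  case 0
  obtain a b where "f = [:a:]" "B 0 = [:b:]"
    using 0 deg by (metis degree_eq_zeroE le_zero_eq)
  moreover from this nz have "b \<noteq> 0" by fastforce
  ultimately show ?case by (intro exI[of _ "\<lambda>_. a / b"]) simp
next
  case (Suc n)
  have lc: "coeff (B (Suc n)) (Suc n) \<noteq> 0"
    using deg nz by (metis leading_coeff_0_iff)
  define \<gamma> where "\<gamma> = coeff f (Suc n) / coeff (B (Suc n)) (Suc n)"
  let ?g = "f - smult \<gamma> (B (Suc n))"
  have deg_g: "degree ?g \<le> Suc n"
    using Suc.prems deg by (intro degree_diff_le order.trans[OF degree_smult_le]) auto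
  have "coeff ?g (Suc n) = 0"
    using lc by (simp add: \<gamma>_def)
  then have "coeff ?g i = 0" if "n < i" for i
    using that deg_g coeff_eq_0[of ?g i] by (cases "i = Suc n") auto
  then have "degree ?g \<le> n"
    by (intro degree_le) blast
  then obtain c where c: "?g = (\<Sum>i\<le>n. smult (c i) (B i))"
    using Suc.IH by blast
  have "f = (\<Sum>i\<le>n. smult (c i) (B i)) + smult \<gamma> (B (Suc n))"
    by (simp add: c[symmetric])
  then have "f = (\<Sum>i\<le>Suc n. smult ((c(Suc n := \<gamma>)) i) (B i))"
    by simp
  moreover have "(c(Suc n := \<gamma>)) (Suc n) * coeff (B (Suc n)) (Suc n) = coeff f (Suc n)"
    using lc by (simp add: \<gamma>_def)
  ultimately show ?case by blast
qed

text \<open>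
  Both orthogonality relations concern this single linear functional, evaluated at products of
  polynomials; the factor \<open>\<pi>\<close> of the second weight is absorbed into its argument.
\<close>

definition integral_against :: "ereal \<Rightarrow> ereal \<Rightarrow> (real \<Rightarrow> real) \<Rightarrow> complex poly \<Rightarrow> complex" where
  "integral_against a b W h =
     set_lebesgue_integral lebesgue (einterval a b)
       (\<lambda>t. poly h (complex_of_real t) * complex_of_real (W t))"

lemma pairing_weight:
  "pairing a b (\<lambda>t. complex_of_real (W t)) f g = integral_against a b W (f * g)"
  "pairing a b (\<lambda>t. poly p (complex_of_real t) * complex_of_real (W t)) f g
     = integral_against a b W (f * (p * g))"
  by (simp_all add: pairing_def integral_against_def mult_ac)

lemma poly_weight_integrable:
  assumes "weight_function a b W"
  shows "set_integrable lebesgue (einterval a b)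
           (\<lambda>t. poly h (complex_of_real t) * complex_of_real (W t))"
proof -
  have "set_integrable lebesgue (einterval a b)
          (\<lambda>t. coeff h i * complex_of_real (t ^ i * W t))" for i
  proof -
    have "set_integrable lebesgue (einterval a b) (\<lambda>t. t ^ i * W t)"
      using assms by (simp add: weight_function_def)
    then have "set_integrable lebesgue (einterval a b) (\<lambda>t. complex_of_real (t ^ i * W t))"
      unfolding set_integrable_def
      by (drule_tac integrable_of_real[where 'a = complex]) (simp add: scaleR_conv_of_real)
    then show ?thesis by (intro set_integrable_mult_right)
  qed
  then have "set_integrable lebesgue (einterval a b)
          (\<lambda>t. \<Sum>i\<le>degree h. coeff h i * complex_of_real (t ^ i * W t))"
    unfolding set_integrable_def scaleR_sum_right by (intro Bochner_Integration.integrable_sum) auto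
  then show ?thesis
    by (simp add: poly_altdef sum_distrib_right mult.assoc)
qed

lemma integral_against_add:
  assumes "weight_function a b W"
  shows "integral_against a b W (f + g) = integral_against a b W f + integral_against a b W g"
  unfolding integral_against_def
  using set_integral_add(2)[OF poly_weight_integrable[OF assms] poly_weight_integrable[OF assms]]
  by (simp add: distrib_right)

lemma integral_against_smult:
  "integral_against a b W (smult c f) = c * integral_against a b W f"
  by (simp add: integral_against_def mult.assoc)

lemma integral_against_sum:
  assumes "weight_function a b W" "finite I"
  shows "integral_against a b W (\<Sum>i\<in>I. smult (c i) (f i))
       = (\<Sum>i\<in>I. c i * integral_against a b W (f i))"
  using assms(2)
proof (induction I)
  case empty
  show ?case by (simp add: integral_against_def)
next
  case (insert i I)
  then show ?case
    by (simp add: integral_against_add[OF assms(1)] integral_against_smult)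
qed

section \<open>The five-term relation\<close>

theorem proposition4p4:
  fixes q :: real and x :: "complex \<Rightarrow> complex"
    and a b :: ereal and W :: "real \<Rightarrow> real"
    and P :: "nat \<Rightarrow> complex poly" and p :: "complex poly" and d :: "nat \<Rightarrow> real"
  assumes "q > 0" and "is_lattice q x"
    and "a < b" and "weight_function a b W"
    and "\<And>n. degree (P n) = n"
    and "\<And>n. d n > 0"
    and "\<And>m n. pairing a b (\<lambda>t. complex_of_real (W t)) (P m) (P n)
                = (if m = n then complex_of_real (d n) else 0)"
    and "degree p \<le> 4"
    and "\<And>m n. m \<ge> 2 \<Longrightarrow> n \<ge> 2 \<Longrightarrow>
           pairing a b (\<lambda>t. poly p (complex_of_real t) * complex_of_real (W t))
             (Dx x (Dx x (P m))) (Dx x (Dx x (P n))) = 0 \<longleftrightarrow> m \<noteq> n"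
  shows "\<exists>\<beta> :: nat \<Rightarrow> nat \<Rightarrow> complex. \<forall>n\<ge>2.
           P n = (\<Sum>j = -2..2::int.
                    smult (\<beta> n (nat (int n + j))) (Dx x (Dx x (P (nat (int n + j)))))) \<and>
           \<beta> n (n + 2) \<noteq> 0"
proof -
  obtain \<sigma> s0 t0 t1 where "quadratic_lattice x \<sigma> s0 t0 t1"
    using is_lattice_quadratic assms(1,2) by blast
  then interpret quadratic_lattice x \<sigma> s0 t0 t1 .
  note W = \<open>weight_function a b W\<close>
  let ?L = "integral_against a b W"
  define Q where "Q k = Dx x (Dx x (P k))" for k
  have degP: "degree (P n) = n" for n by fact
  have degQ: "degree (Q k) = k - 2" for k
    by (simp add: Q_def degree_Dx degP)
  have Q_low: "Q k = 0" if "k < 2" for k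
    using that by (auto simp: Q_def degree_Dx degP intro!: Dx_degree_0)
  have orthP: "?L (P m * P n) = (if m = n then of_real (d n) else 0)" for m n
    using assms(7)[of m n] by (simp add: pairing_weight)
  have orthQ: "?L (Q m * (p * Q n)) = 0 \<longleftrightarrow> m \<noteq> n" if "m \<ge> 2" "n \<ge> 2" for m n
    using assms(9)[OF that] by (simp add: pairing_weight Q_def)
  have L0: "?L 0 = 0" by (simp add: integral_against_def)
  have nzP: "P n \<noteq> 0" for n
    using orthP[of n n] assms(6)[of n] L0 by auto
  have nzQ: "Q (i + 2) \<noteq> 0" for i
    using orthQ[of "i + 2" "i + 2"] L0 by auto
  have orth_lower: "?L (P n * g) = 0" if g: "degree g < n" for n g
  proof -
    have "degree g \<le> n - 1" using g by simp
    from expand_in_graded_basis[OF degP nzP this]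
    obtain c where "g = (\<Sum>i\<le>n - 1. smult (c i) (P i))" by blast
    then have "?L (P n * g) = (\<Sum>i\<le>n - 1. c i * ?L (P n * P i))"
      using integral_against_sum[OF W, of "{..n - 1}" c "\<lambda>i. P n * P i"]
      by (simp add: sum_distrib_left)
    also have "\<dots> = 0"
      using g by (intro sum.neutral) (auto simp: orthP)
    finally show ?thesis .
  qed
  have ex: "\<exists>\<beta>. P n = (\<Sum>j = -2..2::int. smult (\<beta> (nat (int n + j))) (Q (nat (int n + j))))
        \<and> \<beta> (n + 2) \<noteq> 0" if n: "n \<ge> 2" for n
  proof -
    obtain c where c: "P n = (\<Sum>i\<le>n. smult (c i) (Q (i + 2)))"
      and top: "c n * coeff (Q (n + 2)) n = coeff (P n) n"
      using expand_in_graded_basis[of "\<lambda>i. Q (i + 2)" "P n" n] degP degQ nzQ by auto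
    have "c n \<noteq> 0"
      using top nzP[of n] degP[of n] by (metis leading_coeff_0_iff mult_zero_left)
    \<comment> \<open>The coefficient \<open>c i\<close> belongs to \<open>Q (i + 2)\<close>, so the bound is \<open>k < n - 2\<close> for
      \<open>k = i + 2\<close>.\<close>
    have low: "c i = 0" if "i + 4 < n" for i
    proof -
      have "degree (p * Q (i + 2)) < n"
        using degree_mult_le[of p "Q (i + 2)"] degQ[of "i + 2"] \<open>degree p \<le> 4\<close> that by simp
      then have "0 = ?L (P n * (p * Q (i + 2)))"
        by (simp add: orth_lower)
      also have "\<dots> = (\<Sum>k\<le>n. c k * ?L (Q (k + 2) * (p * Q (i + 2))))"
        using integral_against_sum[OF W, of "{..n}" c "\<lambda>k. Q (k + 2) * (p * Q (i + 2))"]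
        by (subst c) (simp add: sum_distrib_right)
      also have "\<dots> = (\<Sum>k\<in>{i}. c k * ?L (Q (k + 2) * (p * Q (i + 2))))"
        using that orthQ by (intro sum.mono_neutral_right) auto
      finally show ?thesis
        using orthQ[of "i + 2" "i + 2"] by auto
    qed
    define \<beta> where "\<beta> k = c (k - 2)" for k
    have "P n = (\<Sum>k = 2..n + 2. smult (\<beta> k) (Q k))"
      unfolding c \<beta>_def
      by (rule sum.reindex_bij_witness[of _ "\<lambda>k. k - 2" "\<lambda>i. i + 2"]) auto
    \<comment> \<open>For \<open>n\<close> = 2 and 3 the window also contains indices below 2; there \<open>Q\<close> vanishes, so the
      value of \<open>\<beta>\<close> produced by truncated subtraction does not matter.\<close>
    also have "\<dots> = (\<Sum>k = n - 2..n + 2. smult (\<beta> k) (Q k))"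
    proof (rule sum.mono_neutral_cong)
      show "smult (\<beta> k) (Q k) = 0" if "k \<in> {2..n + 2} - {n - 2..n + 2}" for k
        using that low[of "k - 2"] by (simp add: \<beta>_def) linarith
      show "smult (\<beta> k) (Q k) = 0" if "k \<in> {n - 2..n + 2} - {2..n + 2}" for k
        using that Q_low[of k] by auto
    qed auto
    also have "\<dots> = (\<Sum>j = -2..2::int. smult (\<beta> (nat (int n + j))) (Q (nat (int n + j))))"
      using n by (intro sum.reindex_bij_witness[of _ "\<lambda>j. nat (int n + j)" "\<lambda>k. int k - int n"]) auto
    finally show ?thesis
      using \<open>c n \<noteq> 0\<close> by (intro exI[of _ \<beta>]) (simp add: \<beta>_def)
  qed
  then obtain \<beta> where "\<And>n. n \<ge> 2 \<Longrightarrow>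
      P n = (\<Sum>j = -2..2::int. smult (\<beta> n (nat (int n + j))) (Q (nat (int n + j)))) \<and> \<beta> n (n + 2) \<noteq> 0"
    by metis
  then show ?thesis
    unfolding Q_def by blast
qed

end
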